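(* Let $\Delta$ be a simplicial complex on $[n]$, let $\mathbf q\cdot\mathbf y\le q_0$ be a facet-defining inequality for $\mathrm{Corr}(\Delta)$, and fix $I\subset[n]$. Let $\Phi_\Delta$ be the matrix representing the generalized covariance map and let $\Psi_\Delta$ be its inverse. Define the linear functional $\mathbf q^{[I]}:=(\mathbf q\Psi_\Delta)^{(I)}\Phi_\Delta$. Then $$\mathbf q^{[I]}\cdot\mathbf y\le q_0-(\mathbf q\Psi_\Delta)\cdot\mathbf d^I$$ is facet-defining for $\mathrm{Corr}(\Delta)$.
   Context: For a simplicial complex $\Delta$ on $[n]$ (a nonempty family of subsets of $[n]$ closed under taking subsets), $\overline\Delta=\Delta\setminus\{\emptyset\}$. Linear functionals on $\mathbb R^{\overline\Delta}$ are written as row vectors. Correlation polytope: $\mathrm{Corr}(\Delta)=\mathrm{conv}\{\mathbf v^S : S\subset[n]\}\subset\mathbb R^{\overline\Delta}$, where $v^S_F=1$ if $F\subset S$ and $0$ otherwise ($F\in\overline\Delta$). For $S\subset[n]$, $\mathbf d^S\in\mathbb R^{\overline\Delta}$ has $d^S_F=1$ if $\#(F\cap S)$ is odd and $0$ if even. Generalized covariance map: the linear map $\mathbb R^{\overline\Delta}\to\mathbb R^{\overline\Delta}$ with $[\phi_\Delta(\mathbf y)]_F=\sum_{\emptyset\ne H\subset F}(-2)^{\#H-1}y_H$; $\Phi_\Delta$ is its matrix (entry in row $F$, column $H$ equal to $(-2)^{\#H-1}$ if $H\subset F$ and $0$ otherwise). It is invertible. For a row vector $\mathbf a$ indexed by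 $\overline\Delta$ and $I\subset[n]$, $\mathbf a^{(I)}$ is defined by $a^{(I)}_F=(-1)^{\#(I\cap F)}a_F$. *)

theory Defs
  imports "HOL-Analysis.Analysis"
begin

text \<open>
  The ground set [n] is a finite set \<^term>\<open>V\<close> of elements of a finite type (so n is the cardinality
  of \<^term>\<open>V\<close>, and n = 0 is included).  For a set \<^term>\<open>J\<close> of coordinates, the space of real vectors
  indexed by \<^term>\<open>J\<close> is the subspace of those vectors, indexed by all sets of vertices, whose
  coordinates outside \<^term>\<open>J\<close> vanish; likewise, a matrix with rows and columns indexed by \<^term>\<open>J\<close> has
  all its entries outside J x J equal to 0.  Row and column vectors have the same type; a row
  vector acts on a column vector by \<^term>\<open>inner\<close> and is multiplied with a matrix by \<open>v*\<close>.
\<close>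

type_synonym 'n set_vec = "(real, 'n set) vec"
type_synonym 'n set_mat = "('n set_vec, 'n set) vec"

definition coord_space :: "'i set \<Rightarrow> (real, 'i::finite) vec set" where
  "coord_space J = {y. \<forall>i. i \<notin> J \<longrightarrow> y $ i = 0}"

definition mat_space :: "'i set \<Rightarrow> ((real, 'i::finite) vec, 'i) vec set" where
  "mat_space J = {A. \<forall>i j. i \<notin> J \<or> j \<notin> J \<longrightarrow> A $ i $ j = 0}"

definition id_mat :: "'i set \<Rightarrow> ((real, 'i::finite) vec, 'i) vec" where
  "id_mat J = (\<chi> i j. if i = j \<and> i \<in> J then 1 else 0)"

definition is_mat_inverse ::
  "'i set \<Rightarrow> ((real, 'i::finite) vec, 'i) vec \<Rightarrow> ((real, 'i) vec, 'i) vec \<Rightarrow> bool" where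
  "is_mat_inverse J A B \<longleftrightarrow> B \<in> mat_space J \<and> A ** B = id_mat J \<and> B ** A = id_mat J"

definition facet_defining ::
  "'i set \<Rightarrow> (real, 'i::finite) vec set \<Rightarrow> (real, 'i) vec \<Rightarrow> real \<Rightarrow> bool" where
  "facet_defining J P a b \<longleftrightarrow>
     a \<in> coord_space J \<and> (\<forall>y\<in>P. a \<bullet> y \<le> b) \<and> {y \<in> P. a \<bullet> y = b} facet_of P"

text \<open>Not every element of \<^term>\<open>V\<close> needs to be a vertex of the complex.\<close>

definition simplicial_complex_on :: "'n set \<Rightarrow> 'n set set \<Rightarrow> bool" where
  "simplicial_complex_on V \<Delta> \<longleftrightarrow>
     \<Delta> \<noteq> {} \<and> \<Delta> \<subseteq> Pow V \<and> (\<forall>F\<in>\<Delta>. \<forall>G. G \<subseteq> F \<longrightarrow> G \<in> \<Delta>)"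

definition nonempty_faces :: "'n set set \<Rightarrow> 'n set set" where
  "nonempty_faces \<Delta> = \<Delta> - {{}}"

definition corr_vec :: "'n set set \<Rightarrow> 'n set \<Rightarrow> 'n::finite set_vec" where
  "corr_vec \<Delta> S = (\<chi> F. if F \<in> nonempty_faces \<Delta> \<and> F \<subseteq> S then 1 else 0)"

definition Corr :: "'n set \<Rightarrow> 'n set set \<Rightarrow> 'n::finite set_vec set" where
  "Corr V \<Delta> = convex hull {corr_vec \<Delta> S |S. S \<subseteq> V}"

definition cut_vec :: "'n set set \<Rightarrow> 'n set \<Rightarrow> 'n::finite set_vec" where
  "cut_vec \<Delta> S = (\<chi> F. if F \<in> nonempty_faces \<Delta> \<and> odd (card (F \<inter> S)) then 1 else 0)"

definition gcov_map :: "'n set set \<Rightarrow> 'n::finite set_vec \<Rightarrow> 'n set_vec" where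
  "gcov_map \<Delta> y = (\<chi> F. if F \<in> nonempty_faces \<Delta>
     then \<Sum>H | H \<noteq> {} \<and> H \<subseteq> F. (-2) ^ (card H - 1) * y $ H else 0)"

definition gcov_matrix :: "'n set set \<Rightarrow> 'n::finite set_mat" where
  "gcov_matrix \<Delta> = matrix (gcov_map \<Delta>)"

text \<open>Existence and uniqueness of the inverse are shown in \<open>gcov_inverse\<close> below.\<close>

definition gcov_inverse_matrix :: "'n set set \<Rightarrow> 'n::finite set_mat" where
  "gcov_inverse_matrix \<Delta> = (THE B. is_mat_inverse (nonempty_faces \<Delta>) (gcov_matrix \<Delta>) B)"

definition sign_switch :: "'n set \<Rightarrow> 'n::finite set_vec \<Rightarrow> 'n set_vec" where
  "sign_switch I a = (\<chi> F. (-1) ^ card (I \<inter> F) * a $ F)"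

definition corr_switch :: "'n set set \<Rightarrow> 'n set \<Rightarrow> 'n::finite set_vec \<Rightarrow> 'n set_vec" where
  "corr_switch \<Delta> I q = sign_switch I (q v* gcov_inverse_matrix \<Delta>) v* gcov_matrix \<Delta>"

lemma gcov_map_linear: "linear (gcov_map \<Delta>)"
  by (rule linearI)
     (auto simp: gcov_map_def vec_eq_iff sum.distrib distrib_left sum_distrib_left algebra_simps)

lemma gcov_matrix_works: "gcov_matrix \<Delta> *v y = gcov_map \<Delta> y"
  unfolding gcov_matrix_def by (simp add: gcov_map_linear)

lemma gcov_matrix_nth:
  fixes \<Delta> :: "'n::finite set set"
  assumes "simplicial_complex_on V \<Delta>"
  shows "gcov_matrix \<Delta> $ F $ H =
    (if F \<in> nonempty_faces \<Delta> \<and> H \<in> nonempty_faces \<Delta> \<and> H \<subseteq> F then (-2) ^ (card H - 1) else 0)"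
proof -
  have "(\<Sum>K | K \<noteq> {} \<and> K \<subseteq> F. (-2) ^ (card K - 1) * (axis H 1 :: 'n set_vec) $ K)
      = (\<Sum>K | K \<noteq> {} \<and> K \<subseteq> F. if K = H then (-2) ^ (card H - 1) else 0)"
    by (rule sum.cong) (auto simp: axis_def)
  also have "\<dots> = (if H \<noteq> {} \<and> H \<subseteq> F then (-2) ^ (card H - 1) else 0)"
    by (subst sum.delta) simp_all
  finally show ?thesis
    using assms
    by (auto simp: gcov_matrix_def matrix_def gcov_map_def nonempty_faces_def
        simplicial_complex_on_def)
qed

lemma gcov_inverse_ex:
  fixes \<Delta> :: "'n::finite set set"
  assumes \<Delta>: "simplicial_complex_on V \<Delta>"
  shows "\<exists>B. is_mat_inverse (nonempty_faces \<Delta>) (gcov_matrix \<Delta>) B"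
proof -
  define J where "J = nonempty_faces \<Delta>"
  define A where "A = gcov_matrix \<Delta>"
  define M :: "'n set_mat" where
    "M = (\<chi> i j. if i \<in> J \<and> j \<in> J then A $ i $ j else if i = j then 1 else 0)"
  have A: "A $ F $ H = (if F \<in> J \<and> H \<in> J \<and> H \<subseteq> F then (-2) ^ (card H - 1) else 0)" for F H
    unfolding A_def J_def by (rule gcov_matrix_nth[OF \<Delta>])
  have "x = 0" if Mx: "M *v x = 0" for x
  proof -
    have row: "(\<Sum>H\<in>UNIV. M $ F $ H * x $ H) = 0" for F
      using arg_cong[OF Mx, of "\<lambda>v. v $ F"] by (simp add: matrix_vector_mult_def)
    have "x $ F = 0" for F
    proof (induction "card F" arbitrary: F rule: less_induct)
      case less
      have "M $ F $ H * x $ H = (if H = F then M $ F $ F * x $ F else 0)" for H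
        using less[of H] psubset_card_mono[of F H] by (auto simp: M_def A)
      then have "(\<Sum>H\<in>UNIV. M $ F $ H * x $ H) = (\<Sum>H\<in>UNIV. if H = F then M $ F $ F * x $ F else 0)"
        by (rule sum.cong[OF refl])
      also have "\<dots> = M $ F $ F * x $ F"
        by (subst sum.delta) simp_all
      finally have "M $ F $ F * x $ F = 0"
        using row[of F] by (rule trans[OF sym])
      then show ?case by (auto simp: M_def A split: if_splits)
    qed
    then show ?thesis by (simp add: vec_eq_iff)
  qed
  then obtain B where BM: "B ** M = mat 1"
    using matrix_left_invertible_ker[of M] by blast
  then have MB: "M ** B = mat 1"
    using matrix_left_right_inverse by blast
  define C :: "'n set_mat" where "C = (\<chi> i j. if i \<in> J \<and> j \<in> J then B $ i $ j else 0)"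
  have "A ** C = id_mat J"
  proof -
    have "(\<Sum>k\<in>UNIV. A $ i $ k * C $ k $ j) = id_mat J $ i $ j" for i j
    proof (cases "i \<in> J \<and> j \<in> J")
      case True
      then have "(\<Sum>k\<in>UNIV. A $ i $ k * C $ k $ j) = (\<Sum>k\<in>UNIV. M $ i $ k * B $ k $ j)"
        by (intro sum.cong) (auto simp: M_def C_def A)
      also have "\<dots> = (M ** B) $ i $ j" by (simp add: matrix_matrix_mult_def)
      finally show ?thesis using True by (simp add: MB mat_def id_mat_def)
    next
      case False
      then have "(\<Sum>k\<in>UNIV. A $ i $ k * C $ k $ j) = 0"
        by (intro sum.neutral) (auto simp: C_def A)
      with False show ?thesis by (auto simp: id_mat_def)
    qed
    then show ?thesis by (simp add: vec_eq_iff matrix_matrix_mult_def)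
  qed
  moreover have "C ** A = id_mat J"
  proof -
    have "(\<Sum>k\<in>UNIV. C $ i $ k * A $ k $ j) = id_mat J $ i $ j" for i j
    proof (cases "i \<in> J \<and> j \<in> J")
      case True
      then have "(\<Sum>k\<in>UNIV. C $ i $ k * A $ k $ j) = (\<Sum>k\<in>UNIV. B $ i $ k * M $ k $ j)"
        by (intro sum.cong) (auto simp: M_def C_def A)
      also have "\<dots> = (B ** M) $ i $ j" by (simp add: matrix_matrix_mult_def)
      finally show ?thesis using True by (simp add: BM mat_def id_mat_def)
    next
      case False
      then have "(\<Sum>k\<in>UNIV. C $ i $ k * A $ k $ j) = 0"
        by (intro sum.neutral) (auto simp: C_def A)
      with False show ?thesis by (auto simp: id_mat_def)
    qed
    then show ?thesis by (simp add: vec_eq_iff matrix_matrix_mult_def)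
  qed
  moreover have "C \<in> mat_space J" by (auto simp: C_def mat_space_def)
  ultimately show ?thesis unfolding is_mat_inverse_def J_def A_def by blast
qed

lemma id_mat_mult:
  assumes "B \<in> mat_space J"
  shows "id_mat J ** B = B" and "B ** id_mat J = B"
proof -
  have "(\<Sum>k\<in>UNIV. id_mat J $ i $ k * B $ k $ j) = B $ i $ j" for i j
  proof -
    have "(\<Sum>k\<in>UNIV. id_mat J $ i $ k * B $ k $ j) = (\<Sum>k\<in>UNIV. if k = i then B $ i $ j else 0)"
      using assms by (intro sum.cong) (auto simp: id_mat_def mat_space_def)
    then show ?thesis by simp
  qed
  then show "id_mat J ** B = B" by (simp add: vec_eq_iff matrix_matrix_mult_def)
  have "(\<Sum>k\<in>UNIV. B $ i $ k * id_mat J $ k $ j) = B $ i $ j" for i j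
  proof -
    have "(\<Sum>k\<in>UNIV. B $ i $ k * id_mat J $ k $ j) = (\<Sum>k\<in>UNIV. if k = j then B $ i $ j else 0)"
      using assms by (intro sum.cong) (auto simp: id_mat_def mat_space_def)
    then show ?thesis by simp
  qed
  then show "B ** id_mat J = B" by (simp add: vec_eq_iff matrix_matrix_mult_def)
qed

lemma is_mat_inverse_unique:
  assumes "is_mat_inverse J A B" "is_mat_inverse J A C"
  shows "B = C"
proof -
  have "B = B ** (A ** C)"
    using assms by (simp add: is_mat_inverse_def id_mat_mult)
  also have "\<dots> = (B ** A) ** C" by (simp add: matrix_mul_assoc)
  also have "\<dots> = C"
    using assms by (simp add: is_mat_inverse_def id_mat_mult)
  finally show ?thesis .
qed

lemma gcov_inverse:
  assumes "simplicial_complex_on V \<Delta>"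
  shows "is_mat_inverse (nonempty_faces \<Delta>) (gcov_matrix \<Delta>) (gcov_inverse_matrix \<Delta>)"
proof -
  have "\<exists>!B. is_mat_inverse (nonempty_faces \<Delta>) (gcov_matrix \<Delta>) B"
    using gcov_inverse_ex[OF assms] is_mat_inverse_unique by (rule ex_ex1I)
  then show ?thesis
    unfolding gcov_inverse_matrix_def by (rule theI')
qed

end

theory Submission
  imports Defs
begin

text \<open>
  Switching is a symmetry of the polytope that is easy to see on cut vectors: the covariance map \<open>\<Phi>\<close> sends
  the vertex \<open>v\<^sup>S\<close> of the correlation polytope to \<open>d\<^sup>S\<close>
  (\<open>gcov_matrix_corr_vec\<close>), and since parities of intersections add, changing the signs of the
  coordinates by \<open>I\<close> and then translating by \<open>d\<^sup>I\<close> sends \<open>d\<^sup>S\<close> to the cut vector of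
  the symmetric difference of \<open>S\<close> and \<open>I\<close> (\<open>sign_switch_cut_vec\<close>).  Conjugating with \<open>\<Phi>\<close> gives
  an affine map \<open>T\<close> that permutes the generators of the correlation polytope by
  \<open>S \<mapsto> sym_diff S I\<close>, and hence is an involution of the polytope
  (\<open>affine_involution_convex_hull\<close>).

  The functional \<open>q\<^sup>[\<^sup>I\<^sup>]\<close> is made so that \<open>q\<^sup>[\<^sup>I\<^sup>] \<bullet> y = q \<bullet> T y - (q \<Psi>) \<bullet> d\<^sup>I\<close>
  (\<open>inner_corr_switch\<close>): the new inequality holds at \<open>y\<close>, or is tight there, exactly when the
  old one is so at \<open>T y\<close>.  Thus the new face is the image of the old facet under an affine
  automorphism of the polytope, and its dimension is the same
  (\<open>facet_defining_affine_involution\<close>).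
\<close>

text \<open>
  After multiplication by \<open>-2\<close> and with the empty set added, the sum is the binomial expansion of
  \<open>(1 - 2) ^ card A\<close>.
\<close>

lemma sum_nonempty_subsets_power_minus_two:
  fixes A :: "'a set"
  assumes "finite A"
  shows "(\<Sum>H | H \<noteq> {} \<and> H \<subseteq> A. (-2) ^ (card H - 1)) = (if odd (card A) then 1 else 0 :: real)"
proof -
  have "-2 * (\<Sum>H | H \<noteq> {} \<and> H \<subseteq> A. (-2) ^ (card H - 1)) = (\<Sum>H\<in>Pow A - {{}}. (-2 :: real) ^ card H)"
  proof -
    have "-2 * (-2 :: real) ^ (card H - 1) = (-2) ^ card H" if "H \<in> Pow A - {{}}" for H
    proof -
      have "0 < card H"
        using that assms finite_subset by (auto simp: card_gt_0_iff)
      then show ?thesis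
        by (simp add: power_eq_if)
    qed
    moreover have "{H. H \<noteq> {} \<and> H \<subseteq> A} = Pow A - {{}}"
      by auto
    ultimately show ?thesis
      unfolding sum_distrib_left by (intro sum.cong) auto
  qed
  also have "\<dots> = (\<Sum>H\<in>Pow A. (-2) ^ card H) - 1"
    using assms by (subst sum_diff1) auto
  also have "(\<Sum>H\<in>Pow A. (-2 :: real) ^ card H) = (-1) ^ card A"
    using prod_add[OF assms, of "\<lambda>_. -2 :: real" "\<lambda>_. 1"] by simp
  finally show ?thesis
    by (cases "even (card A)") auto
qed

text \<open>
  A face \<open>H\<close> contributes to row \<open>F\<close> just when it lies in both \<open>F\<close> and \<open>S\<close>, so the entry depends
  only on the parity of \<open>card (F \<inter> S)\<close>.
\<close>

lemma gcov_matrix_corr_vec: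
  assumes "simplicial_complex_on V \<Delta>"
  shows "gcov_matrix \<Delta> *v corr_vec \<Delta> S = cut_vec \<Delta> S"
proof -
  have "gcov_map \<Delta> (corr_vec \<Delta> S) $ F = cut_vec \<Delta> S $ F" for F
  proof (cases "F \<in> nonempty_faces \<Delta>")
    case True
    have "(\<Sum>H | H \<noteq> {} \<and> H \<subseteq> F. (-2) ^ (card H - 1) * corr_vec \<Delta> S $ H)
        = (\<Sum>H | H \<noteq> {} \<and> H \<subseteq> F \<inter> S. (-2) ^ (card H - 1))"
      using True assms
      by (intro sum.mono_neutral_cong_right)
         (auto simp: corr_vec_def nonempty_faces_def simplicial_complex_on_def)
    also have "\<dots> = (if odd (card (F \<inter> S)) then 1 else 0)"
      by (intro sum_nonempty_subsets_power_minus_two) simp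
    finally show ?thesis
      using True by (simp add: gcov_map_def cut_vec_def)
  qed (simp add: gcov_map_def cut_vec_def)
  then show ?thesis
    by (simp add: gcov_matrix_works vec_eq_iff)
qed

lemma gcov_inverse_matrix_cut_vec:
  assumes "simplicial_complex_on V \<Delta>"
  shows "gcov_inverse_matrix \<Delta> *v cut_vec \<Delta> S = corr_vec \<Delta> S"
proof -
  have "(\<Sum>j\<in>UNIV. id_mat (nonempty_faces \<Delta>) $ F $ j * corr_vec \<Delta> S $ j)
      = (\<Sum>j\<in>UNIV. if j = F then corr_vec \<Delta> S $ F else 0)" for F
    by (intro sum.cong) (auto simp: id_mat_def corr_vec_def)
  then have "id_mat (nonempty_faces \<Delta>) *v corr_vec \<Delta> S = corr_vec \<Delta> S"
    by (simp add: vec_eq_iff matrix_vector_mult_def)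
  moreover have "gcov_inverse_matrix \<Delta> ** gcov_matrix \<Delta> = id_mat (nonempty_faces \<Delta>)"
    using gcov_inverse[OF assms] by (simp add: is_mat_inverse_def)
  ultimately show ?thesis
    by (metis gcov_matrix_corr_vec[OF assms] matrix_vector_mul_assoc)
qed

text \<open>
  In a coordinate \<open>F\<close> that meets \<open>I\<close> in an even number of elements the left-hand side leaves
  \<open>d\<^sup>S\<close> unchanged; in the other coordinates of the complex it replaces the entry \<open>x\<close> by \<open>1 - x\<close>.
  This is addition of parities.
\<close>

lemma sign_switch_cut_vec:
  "sign_switch I (cut_vec \<Delta> S) + cut_vec \<Delta> I = cut_vec \<Delta> (sym_diff S I)"
proof -
  have "odd (card (F \<inter> sym_diff S I)) \<longleftrightarrow> odd (card (F \<inter> S)) \<noteq> odd (card (F \<inter> I))" for F :: "'a set"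
  proof -
    have "card (F \<inter> S) = card (F \<inter> S - I) + card (F \<inter> S \<inter> I)"
      by (subst card_Un_disjoint[symmetric]) (auto intro: arg_cong[where f = card])
    moreover have "card (F \<inter> I) = card (F \<inter> I - S) + card (F \<inter> S \<inter> I)"
      by (subst card_Un_disjoint[symmetric]) (auto intro: arg_cong[where f = card])
    moreover have "card (F \<inter> sym_diff S I) = card (F \<inter> S - I) + card (F \<inter> I - S)"
      by (subst card_Un_disjoint[symmetric]) (auto intro: arg_cong[where f = card])
    ultimately show ?thesis
      by presburger
  qed
  then show ?thesis
    by (auto simp: vec_eq_iff sign_switch_def cut_vec_def Int_commute)
qed

lemma linear_sign_switch: "linear (sign_switch I)"
  by (rule linearI) (auto simp: sign_switch_def vec_eq_iff algebra_simps)

lemma inner_sign_switch: "sign_switch I a \<bullet> x = a \<bullet> sign_switch I x"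
  by (auto simp: inner_vec_def sign_switch_def intro!: sum.cong)

text \<open>
  The switching of cut vectors by \<open>I\<close>, transported to correlation vectors by the covariance map.
\<close>

definition corr_switch_map :: "'n set set \<Rightarrow> 'n set \<Rightarrow> 'n::finite set_vec \<Rightarrow> 'n set_vec" where
  "corr_switch_map \<Delta> I y =
     gcov_inverse_matrix \<Delta> *v (sign_switch I (gcov_matrix \<Delta> *v y) + cut_vec \<Delta> I)"

lemma corr_switch_map_affine:
  obtains f c where "linear f" "corr_switch_map \<Delta> I = (\<lambda>y. f y + c)"
proof
  show "linear (\<lambda>y. gcov_inverse_matrix \<Delta> *v sign_switch I (gcov_matrix \<Delta> *v y))"
    using linear_compose[OF linear_compose[OF matrix_vector_mul_linear linear_sign_switch]
        matrix_vector_mul_linear]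
    by (simp add: o_def)
  show "corr_switch_map \<Delta> I = (\<lambda>y. gcov_inverse_matrix \<Delta> *v sign_switch I (gcov_matrix \<Delta> *v y)
      + gcov_inverse_matrix \<Delta> *v cut_vec \<Delta> I)"
    by (auto simp: corr_switch_map_def matrix_vector_right_distrib)
qed

lemma corr_switch_map_corr_vec:
  assumes "simplicial_complex_on V \<Delta>"
  shows "corr_switch_map \<Delta> I (corr_vec \<Delta> S) = corr_vec \<Delta> (sym_diff S I)"
  by (simp add: corr_switch_map_def gcov_matrix_corr_vec[OF assms] sign_switch_cut_vec
      gcov_inverse_matrix_cut_vec[OF assms])

text \<open>
  Sign switching is self-adjoint and \<open>v*\<close> is adjoint to \<open>*v\<close>, so the switched functional is the
  composition of \<open>q\<close> with the linear part of \<open>corr_switch_map\<close>; the last term corrects for the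
  translation.
\<close>

lemma inner_corr_switch:
  "corr_switch \<Delta> I q \<bullet> y
     = q \<bullet> corr_switch_map \<Delta> I y - (q v* gcov_inverse_matrix \<Delta>) \<bullet> cut_vec \<Delta> I"
  by (simp add: corr_switch_def corr_switch_map_def dot_lmul_matrix inner_sign_switch
      matrix_vector_right_distrib inner_add_right)

lemma corr_switch_in_coord_space:
  assumes "simplicial_complex_on V \<Delta>"
  shows "corr_switch \<Delta> I q \<in> coord_space (nonempty_faces \<Delta>)"
  by (auto simp: coord_space_def corr_switch_def vector_matrix_mult_def gcov_matrix_nth[OF assms])

text \<open>
  An affine map commutes with convex combinations, so what it does to the generators it does to
  their hull.  The involution is asked for on the generators alone because \<open>corr_switch_map\<close> is not
  injective on the whole vector space: its matrices kill the coordinates outside the complex.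
\<close>

lemma affine_involution_convex_hull:
  fixes f :: "'a::real_vector \<Rightarrow> 'a"
  assumes f: "linear f" and T: "T = (\<lambda>y. f y + c)"
    and "T ` X \<subseteq> X" and "\<And>x. x \<in> X \<Longrightarrow> T (T x) = x"
  shows "T ` (convex hull X) \<subseteq> convex hull X"
    and "\<And>x. x \<in> convex hull X \<Longrightarrow> T (T x) = x"
proof -
  have T_combination: "T (u *\<^sub>R x + v *\<^sub>R y) = u *\<^sub>R T x + v *\<^sub>R T y" if "u + v = 1" for u v x y
    using that by (simp add: T linear_add[OF f] linear_scale[OF f] algebra_simps
        flip: scaleR_add_left)
  have "convex hull X \<subseteq> {y. T y \<in> convex hull X}"
    using assms(3) hull_subset[of X convex] convex_convex_hull[of X]
    by (intro hull_minimal convexI) (auto simp: T_combination convexD)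
  then show "T ` (convex hull X) \<subseteq> convex hull X"
    by blast
  have "convex hull X \<subseteq> {y. T (T y) = y}"
    using assms(4) by (intro hull_minimal convexI) (auto simp: T_combination)
  then show "\<And>x. x \<in> convex hull X \<Longrightarrow> T (T x) = x"
    by blast
qed

text \<open>
  The new face is exposed by its own inequality, so only its dimension is in question.  An affine map
  cannot raise the dimension of a set, and \<open>T\<close> carries each of the two faces onto the other; therefore
  they have equal dimension, even if \<open>T\<close> is not injective outside \<open>P\<close>.
\<close>

lemma facet_defining_affine_involution:
  fixes f :: "(real, 'i::finite) vec \<Rightarrow> (real, 'i) vec"
  assumes "linear f" and T: "T = (\<lambda>y. f y + c)"
    and "convex P" and TP: "T ` P \<subseteq> P" and TT: "\<And>x. x \<in> P \<Longrightarrow> T (T x) = x"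
    and facet: "facet_defining J P a b"
    and "a' \<in> coord_space J" and a': "\<And>y. y \<in> P \<Longrightarrow> a' \<bullet> y = a \<bullet> T y - d"
  shows "facet_defining J P a' (b - d)"
proof -
  define F G where "F = {y \<in> P. a \<bullet> y = b}" and "G = {y \<in> P. a' \<bullet> y = b - d}"
  have valid: "a' \<bullet> y \<le> b - d" if "y \<in> P" for y
    using that facet TP a' by (auto simp: facet_defining_def)
  have F: "F facet_of P"
    using facet by (simp add: facet_defining_def F_def)
  have TF: "T ` F \<subseteq> G" and TG: "T ` G \<subseteq> F"
    using TP by (auto simp: F_def G_def a' TT)
  have TFG: "T ` F = G" and TGF: "T ` G = F"
    using TF TG TT by (force simp: F_def G_def)+
  have aff_dim_le: "aff_dim (T ` S) \<le> aff_dim S" for S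
  proof -
    have "T ` S = (+) c ` f ` S"
      by (auto simp: T image_image add.commute)
    then show ?thesis
      using aff_dim_linear_image_le[OF \<open>linear f\<close>, of S] by (simp add: aff_dim_translation_eq)
  qed
  have "aff_dim G = aff_dim F"
    using aff_dim_le[of F] aff_dim_le[of G] by (simp add: TFG TGF)
  moreover have "G face_of P"
  proof -
    have "G = P \<inter> {x. a' \<bullet> x = b - d}"
      by (auto simp: G_def)
    then show ?thesis
      using face_of_Int_supporting_hyperplane_le[OF \<open>convex P\<close>, of a' "b - d"] valid by simp
  qed
  ultimately have "G facet_of P"
    using F TFG by (auto simp: facet_of_def)
  then show ?thesis
    using assms(7) valid by (simp add: facet_defining_def G_def)
qed

theorem corollary3p10:
  fixes V :: "'n::finite set" and \<Delta> :: "'n set set" and I :: "'n set"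
    and q :: "'n set_vec" and q0 :: real
  assumes "simplicial_complex_on V \<Delta>"
    and "facet_defining (nonempty_faces \<Delta>) (Corr V \<Delta>) q q0"
    and "I \<subseteq> V"
  shows "facet_defining (nonempty_faces \<Delta>) (Corr V \<Delta>) (corr_switch \<Delta> I q)
           (q0 - (q v* gcov_inverse_matrix \<Delta>) \<bullet> cut_vec \<Delta> I)"
proof -
  let ?T = "corr_switch_map \<Delta> I" and ?X = "{corr_vec \<Delta> S |S. S \<subseteq> V}"
  obtain f c where f: "linear f" and T: "?T = (\<lambda>y. f y + c)"
    by (rule corr_switch_map_affine)
  have TX: "?T ` ?X \<subseteq> ?X"
  proof -
    have "?T (corr_vec \<Delta> S) \<in> ?X" if "S \<subseteq> V" for S
    proof -
      have "sym_diff S I \<subseteq> V"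
        using that \<open>I \<subseteq> V\<close> by blast
      then show ?thesis
        unfolding corr_switch_map_corr_vec[OF assms(1)] by blast
    qed
    then show ?thesis
      by blast
  qed
  have TTX: "?T (?T x) = x" if "x \<in> ?X" for x
  proof -
    have "sym_diff (sym_diff S I) I = S" for S
      by blast
    then show ?thesis
      using that by (auto simp: corr_switch_map_corr_vec[OF assms(1)])
  qed
  note involution = affine_involution_convex_hull[OF f T TX TTX, folded Corr_def]
  have "convex (Corr V \<Delta>)"
    by (simp add: Corr_def)
  then show ?thesis
    by (rule facet_defining_affine_involution[OF f T _ involution assms(2)
          corr_switch_in_coord_space[OF assms(1)] inner_corr_switch])
qed

end
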